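(* For all integers $m\geq 4$ we have $$\mathrm{disp}(\mathcal{P}_m^{U})=\frac52\cdot\frac{1}{2^m},$$ where $\mathcal{P}_m^U$ is the digital net in base $2$ generated by the matrices $C_1=J_m$ and $C_2=U_m$.
   Context: Dispersion: let $\mathcal{B}:=\{[x_1,y_1)\times[x_2,y_2)\mid 0\le x_1\le y_1\le 1,\ 0\le x_2\le y_2\le 1\}$. For a finite point set $\mathcal{P}\subset[0,1]^2$, $\mathrm{disp}(\mathcal{P}):=\sup_{B\in\mathcal{B},\,B\cap\mathcal{P}=\emptyset}\lambda(B)$, where $\lambda(B)$ is the area of $B$. Digital nets in base $2$: identify $\mathbb{Z}_2$, the field with $2$ elements, with $\{0,1\}$. Let $C_1,C_2$ be two $m\times m$ matrices over $\mathbb{Z}_2$. For $n\in\{0,1,\dots,2^m-1\}$ with binary expansion $n=e_1+2e_2+\dots+2^{m-1}e_m$, $e_i\in\{0,1\}$, put $\vec n=(e_1,\dots,e_m)^\top$, compute $C_j\vec n=:(y^{(j)}_{n,1},\dots,y^{(j)}_{n,m})^\top$ over $\mathbb{Z}_2$, set $x_n^{(j)}=\sum_{i=1}^m y^{(j)}_{n,i}\,2^{-i}$ for $j=1,2$, and $\boldsymbol{x}_n=(x_n^{(1)},x_n^{(2)})$. The digital net generated by $C_1$ and $C_2$ is $\{\boldsymbol{x}_0,\dots,\boldsymbol{x}_{2^m-1}\}$. $J_m$ is the $m\times m$ matrix with entries $1$ on the anti-diagonal (positions $(i,m+1-i)$) and $0$ elsewhere. $U_m$ is the $m\times m$ upper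 triangular matrix over $\mathbb{Z}_2$ with all entries on and above the main diagonal equal to $1$ and all entries below it equal to $0$. *)

theory Defs
  imports "HOL-Analysis.Lebesgue_Measure" "HOL-Library.Z2" "Jordan_Normal_Form.Matrix"
begin

definition boxes :: "(real \<times> real) set set" where
  "boxes = {{x1..<y1} \<times> {x2..<y2} | x1 y1 x2 y2.
     0 \<le> x1 \<and> x1 \<le> y1 \<and> y1 \<le> 1 \<and> 0 \<le> x2 \<and> x2 \<le> y2 \<and> y2 \<le> 1}"

text \<open>The supremum is taken over a set of reals that is nonempty (degenerate boxes are empty,
  so they avoid every \<open>P\<close>) and bounded above by 1.\<close>

definition disp :: "(real \<times> real) set \<Rightarrow> real" where
  "disp P = (SUP B \<in> {B \<in> boxes. B \<inter> P = {}}. measure lborel B)"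

text \<open>Vectors and matrices are indexed from 0: the component with index \<open>i\<close> below is the
  \<open>(i + 1)\<close>-st one in the usual numbering, so the weight \<open>2\<^sup>-\<^sup>i\<close> of the \<open>i\<close>-th digit becomes
  \<open>1 / 2 ^ (i + 1)\<close>, and the anti-diagonal positions \<open>(i, m + 1 - i)\<close> become those with
  \<open>i + j + 1 = m\<close>.\<close>

definition digit_vec :: "nat \<Rightarrow> nat \<Rightarrow> bit vec" where
  "digit_vec m n = Matrix.vec m (\<lambda>i. of_nat (n div 2 ^ i mod 2))"

definition net_coord :: "nat \<Rightarrow> bit mat \<Rightarrow> nat \<Rightarrow> real" where
  "net_coord m C n = (\<Sum>i<m. of_bit (vec_index (C *\<^sub>v digit_vec m n) i) / 2 ^ (i + 1))"

text \<open>Meaningful for \<open>C1, C2 \<in> carrier_mat m m\<close>.\<close>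

definition digital_net :: "nat \<Rightarrow> bit mat \<Rightarrow> bit mat \<Rightarrow> (real \<times> real) set" where
  "digital_net m C1 C2 = (\<lambda>n. (net_coord m C1 n, net_coord m C2 n)) ` {0..2 ^ m - 1}"

definition J_mat :: "nat \<Rightarrow> bit mat" where
  "J_mat m = Matrix.mat m m (\<lambda>(i, j). if i + j + 1 = m then 1 else 0)"

definition U_mat :: "nat \<Rightarrow> bit mat" where
  "U_mat m = Matrix.mat m m (\<lambda>(i, j). if i \<le> j then 1 else 0)"

end

theory Submission
  imports Defs
begin

text \<open>
  Put \<open>N = 2 ^ m\<close>. Since \<open>J\<close> reverses the order of the binary digits, the \<open>n\<close>-th point of the net is
  \<open>(n / N, h n / N)\<close>, and since \<open>U\<close> forms sums of final segments of digits, the binary digits of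
  \<open>h n\<close>, the most significant one first, are \<open>t n, t (n div 2), t (n div 4), \<dots>\<close> with the
  Thue-Morse sequence \<open>t\<close>. The dispersion asks for the largest area of an open grid box \<open>a < n < b\<close>,
  \<open>c < h n < d\<close> without points, and the claim is \<open>(b - a) (d - c) \<le> 5 / 2 N\<close>, with equality
  for some box.

  Two rigidity properties carry the upper bound; let \<open>N = 2 ^ k * 2 ^ l\<close>.
  \<^item> Columns: over a block \<open>2 ^ k j \<le> n < 2 ^ k (j + 1)\<close> the heights are exactly the numbers
    below \<open>N\<close> in one residue class modulo \<open>2 ^ l\<close>, because the last \<open>l\<close> digits of \<open>h n\<close> depend on
    \<open>j\<close> only and the first \<open>k\<close> are arbitrary.
  \<^item> Rows: points with heights in one dyadic interval of length \<open>2 ^ l\<close> have columns that agree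
    modulo \<open>2 ^ k / 2\<close>, because consecutive digits of \<open>h n\<close> determine the digits of \<open>n\<close>.

  Let \<open>X = 2 ^ p (2 v + 1)\<close> be the integer strictly between \<open>a\<close> and \<open>b\<close> with the largest power of
  two (the pivot). The box extends by at most \<open>2 ^ p\<close> to each side of \<open>X\<close>. If its two sides have
  sufficiently different lengths, one dyadic block on the longer side forces a height that is small
  enough. Otherwise let \<open>K = 2 ^ k\<close> be the largest power of two for which the box contains a block
  of \<open>K\<close> columns on each side of \<open>X\<close>, and let \<open>H = N / K\<close>. The residues modulo \<open>H\<close> of the blocks near \<open>X\<close> are
  explicit: up to a reflection and a common shift their leading digits are \<open>11\<dots>1\<close> on the right of
  \<open>X\<close> and \<open>\<dots>01010\<close> on the left. Hence two blocks adjacent to \<open>X\<close> leave gaps of about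
  \<open>2 / 3 H\<close>, while the width can be close to \<open>4 K\<close>; their product is slightly too large. But a
  box that uses this gap is stopped on the left and on the right by points in the same row, so that
  by the row property its width is at most \<open>7 / 2 K\<close>. Blocks further away are treated in the
  same way (\<open>narrow_case\<close>, \<open>wide_right_case\<close>, \<open>wide_left_case\<close>), and \<open>empty_box_area\<close> combines the
  cases.

  For the lower bound, the columns \<open>3, 4, 5, 6\<close> have heights \<open>2, 7, 3, 1\<close> in units of \<open>N / 8\<close>, so the
  box \<open>2 < n < 7\<close>, \<open>3 / 8 N < h n < 7 / 8 N\<close> is empty and has the area \<open>5 * N / 2\<close>.
\<close>

section \<open>The Thue-Morse sequence and the heights of the points\<close>

fun thue_morse :: "nat \<Rightarrow> bool" where
  "thue_morse n = (if n = 0 then False else odd n \<noteq> thue_morse (n div 2))"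

declare thue_morse.simps [simp del]

lemma thue_morse_0 [simp]: "\<not> thue_morse 0"
  by (simp add: thue_morse.simps)

lemma thue_morse_double [simp]: "thue_morse (2 * n) = thue_morse n"
  by (cases "n = 0") (simp_all add: thue_morse.simps [of "2 * n"])

lemma thue_morse_Suc_double [simp]: "thue_morse (Suc (2 * n)) = (\<not> thue_morse n)"
  by (simp add: thue_morse.simps [of "Suc (2 * n)"])

text \<open>The flag \<open>g\<close> complements every digit. The net itself has \<open>g = False\<close>; its reflection
  \<open>y \<mapsto> 2 ^ m - 1 - y\<close> has \<open>g = True\<close>. Admitting both allows a reflection to be assumed away.\<close>

primrec height :: "bool \<Rightarrow> nat \<Rightarrow> nat \<Rightarrow> nat" where
  "height g 0 n = 0"
| "height g (Suc m) n = of_bool (thue_morse n \<noteq> g) * 2 ^ m + height g m (n div 2)"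

lemma height_double:
  "height g (Suc m) (2 * n) = of_bool (thue_morse n \<noteq> g) * 2 ^ m + height g m n"
  "height g (Suc m) (Suc (2 * n)) = of_bool (thue_morse n = g) * 2 ^ m + height g m n"
  by auto

lemma height_less: "height g m n < 2 ^ m"
proof (induction m arbitrary: n)
  case (Suc m)
  show ?case using Suc [of "n div 2"] by auto
qed simp

lemma int_height_less: "int (height g m n) < 2 ^ m"
  using height_less [of g m n] by (simp flip: of_nat_less_iff)

lemma height_add: "height g (k + l) n = 2 ^ l * height g k n + height g l (n div 2 ^ k)"
proof (induction k arbitrary: n)
  case (Suc k)
  show ?case by (simp add: Suc.IH power_add div_mult2_eq algebra_simps)
qed simp

lemma height_complement: "height g m n + height (\<not> g) m n = 2 ^ m - 1"
proof (induction m arbitrary: n)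
  case (Suc m)
  have "(1::nat) \<le> 2 ^ m" by simp
  then show ?case using Suc [of "n div 2"] by auto
qed simp

text \<open>Going down one level, the two numbers \<open>2 n\<close> and \<open>2 n + 1\<close> have different Thue-Morse values, so
  exactly one of them produces the required leading digit.\<close>

lemma height_surj_on_block:
  assumes "y < 2 ^ k"
  shows "\<exists>n. n div 2 ^ k = j \<and> height g k n = y"
  using assms
proof (induction k arbitrary: y)
  case (Suc k)
  obtain n where n: "n div 2 ^ k = j" "height g k n = y mod 2 ^ k"
    using Suc.IH [of "y mod 2 ^ k"] by auto
  define b where "b = (y div 2 ^ k = 1)"
  have "y div 2 ^ k < 2" using Suc.prems by (simp add: less_mult_imp_div_less)
  then have "y div 2 ^ k = of_bool b" by (auto simp: b_def)
  then have y: "y = of_bool b * 2 ^ k + y mod 2 ^ k"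
    by (metis div_mult_mod_eq)
  define n' where "n' = (if (thue_morse n \<noteq> g) = b then 2 * n else Suc (2 * n))"
  have d: "n' div 2 = n" by (auto simp: n'_def)
  have "n' div 2 ^ Suc k = j" using n d by (simp add: div_mult2_eq)
  moreover have "height g (Suc k) n' = y"
    using d n y by (auto simp: n'_def)
  ultimately show ?case by blast
qed simp

text \<open>The row property. Equal heights mean equal Thue-Morse values of \<open>n div 2 ^ i\<close> and
  \<open>n' div 2 ^ i\<close> for all \<open>i < k\<close>, and two consecutive Thue-Morse values determine the digit in
  between; this fixes \<open>k - 1\<close> binary digits. The factor \<open>2\<close> makes the statement correct for
  \<open>k = 0\<close> as well.\<close>

lemma height_eq_imp_cong:
  assumes "height g k n = height g k n'"
  shows "2 ^ k dvd 2 * (int n - int n')"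
  using assms
proof (induction k arbitrary: n n')
  case (Suc k)
  have lt: "height g k (n div 2) < 2 ^ k" "height g k (n' div 2) < 2 ^ k"
    by (rule height_less)+
  have top: "(thue_morse n \<noteq> g) = (thue_morse n' \<noteq> g)"
    and rest: "height g k (n div 2) = height g k (n' div 2)"
    using Suc.prems lt by (auto split: if_splits simp: of_bool_def)
  have IH: "2 ^ k dvd 2 * (int (n div 2) - int (n' div 2))"
    by (rule Suc.IH [OF rest])
  show ?case
  proof (cases k)
    case (Suc k')
    have "(thue_morse (n div 2) \<noteq> g) = (thue_morse (n' div 2) \<noteq> g)"
      using rest height_less [of g k' "n div 2 div 2"] height_less [of g k' "n' div 2 div 2"]
      by (auto split: if_splits simp: of_bool_def Suc)
    with top have "odd n = odd n'"
      by (metis (full_types) bot_nat_0.extremum_unique even_zero thue_morse.simps div_0)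
    then have "n mod 2 = n' mod 2" by presburger
    then have "int n - int n' = 2 * (int (n div 2) - int (n' div 2))"
      by presburger
    moreover have "2 * 2 ^ k dvd 2 * (2 * (int (n div 2) - int (n' div 2)))"
      using IH by (rule mult_dvd_mono [OF dvd_refl])
    ultimately show ?thesis by simp
  qed simp
qed simp

text \<open>The column property.\<close>

lemma height_surj_on_column_block:
  assumes "0 \<le> y" "y < 2 ^ (k + l)" "y mod 2 ^ l = int (height g l j)"
  shows "\<exists>n. n div 2 ^ k = j \<and> int (height g (k + l) n) = y"
proof -
  have "y div 2 ^ l < 2 ^ k"
  proof (rule ccontr)
    assume "\<not> y div 2 ^ l < 2 ^ k"
    then have "2 ^ l * 2 ^ k \<le> 2 ^ l * (y div 2 ^ l)" by simp
    also have "\<dots> \<le> y" by (simp add: minus_mod_eq_mult_div [symmetric])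
    finally show False using assms(2) by (simp add: power_add mult.commute)
  qed
  then have "nat (y div 2 ^ l) < 2 ^ k"
    using assms(1) by (simp add: nat_less_iff pos_imp_zdiv_nonneg_iff)
  then obtain n where n: "n div 2 ^ k = j" "height g k n = nat (y div 2 ^ l)"
    using height_surj_on_block by blast
  have "int (height g (k + l) n) = 2 ^ l * (y div 2 ^ l) + y mod 2 ^ l"
    using assms n by (simp add: height_add pos_imp_zdiv_nonneg_iff)
  then show ?thesis using n by auto
qed

section \<open>Residues of the column blocks near a pivot\<close>

definition pivot :: "nat \<Rightarrow> nat \<Rightarrow> nat" where
  "pivot s v = 2 ^ s * (2 * v + 1)"

lemma pivot_0: "pivot 0 v = Suc (2 * v)"
  and pivot_Suc: "pivot (Suc s) v = 2 * pivot s v"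
  and pivot_pos: "0 < pivot s v"
  by (simp_all add: pivot_def)

lemma pivot_shift:
  "pivot (Suc s) v - 1 = Suc (2 * (pivot s v - 1))"
  "pivot (Suc s) v - 2 = 2 * (pivot s v - 1)"
  "pivot (Suc (Suc s)) v - 3 = Suc (2 * (pivot (Suc s) v - 2))"
  "pivot (Suc s) v + 1 = Suc (2 * pivot s v)"
  "pivot (Suc s) v + 2 = 2 * (pivot s v + 1)"
  "pivot (Suc s) v + 3 = Suc (2 * (pivot s v + 1))"
  using pivot_pos [of s v] by (simp_all add: pivot_Suc)

lemma thue_morse_pivot: "thue_morse (pivot s v) = (\<not> thue_morse v)"
  by (induction s) (simp_all add: pivot_0 pivot_Suc)

lemma thue_morse_before_pivot: "thue_morse (pivot s v - 1) = (thue_morse v = even s)"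
  by (induction s) (auto simp: pivot_0 pivot_shift(1) simp del: One_nat_def)

text \<open>If \<open>thue_morse v = g\<close>, then the \<open>s + 1\<close> leading digits at \<open>pivot s v\<close> are all \<open>1\<close>: stripping
  factors \<open>2\<close> preserves the Thue-Morse value, up to the final odd number \<open>2 v + 1\<close>. At
  \<open>pivot s v - 1\<close>, which ends in \<open>s\<close> ones, every division by \<open>2\<close> changes the value, so the digits
  alternate. The neighbours further away differ from these two in the leading digits only.\<close>

context
  fixes v :: nat and g :: bool
  assumes g: "thue_morse v = g"
begin

lemma height_pivot: "height g (Suc s) (pivot s v) + 1 = 2 ^ Suc s"
proof (induction s)
  case 0
  show ?case using g by (simp add: pivot_0)
next
  case (Suc s)
  then show ?case
    using g by (simp add: pivot_Suc [of s] height_double thue_morse_pivot del: height.simps)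
qed

lemma height_pivot_plus_1: "height g (Suc (Suc s)) (pivot (Suc s) v + 1) + 1 = 2 ^ Suc s"
  using height_pivot [of s] g
  by (simp only: pivot_shift height_double) (simp add: thue_morse_pivot)

lemma height_pivot_plus_2:
  "height g (Suc (Suc (Suc s))) (pivot (Suc (Suc s)) v + 2) + 1 = 2 ^ Suc s"
proof -
  have "thue_morse (pivot (Suc s) v + 1) = g"
    using g by (simp only: pivot_shift) (simp add: thue_morse_pivot)
  then show ?thesis
    using height_pivot_plus_1 [of s] by (simp only: pivot_shift(5) height_double) simp
qed

lemma height_pivot_plus_3:
  "height g (Suc (Suc (Suc s))) (pivot (Suc (Suc s)) v + 3) + 1 = 2 ^ Suc (Suc s) + 2 ^ Suc s"
proof -
  have "thue_morse (pivot (Suc s) v + 1) = g"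
    using g by (simp only: pivot_shift) (simp add: thue_morse_pivot)
  then show ?thesis
    using height_pivot_plus_1 [of s] by (simp only: pivot_shift(6) height_double) simp
qed

lemma height_pivot_minus_1_Suc:
  "height g (Suc (Suc s)) (pivot (Suc s) v - 1)
     = of_bool (even s) * 2 ^ Suc s + height g (Suc s) (pivot s v - 1)"
  using g by (simp only: pivot_shift height_double) (simp add: thue_morse_before_pivot del: One_nat_def)

text \<open>The alternating numbers \<open>\<dots>01010\<close> are one third, or two thirds, of a power of two up to
  rounding.\<close>

lemma height_pivot_minus_1:
  "3 * height g (Suc s) (pivot s v - 1) + 2 = 2 ^ Suc s * (if even s then 1 else 2)"
proof (induction s)
  case 0
  show ?case using g by (simp add: pivot_0)
next
  case (Suc s)
  then show ?case by (auto simp: height_pivot_minus_1_Suc simp del: height.simps One_nat_def)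
qed

lemma height_pivot_minus_2:
  "height g (Suc (Suc s)) (pivot (Suc s) v - 2)
     = of_bool (odd s) * 2 ^ Suc s + height g (Suc s) (pivot s v - 1)"
  using g by (simp only: pivot_shift height_double) (simp add: thue_morse_before_pivot del: One_nat_def)

lemma height_pivot_minus_3:
  "height g (Suc (Suc (Suc s))) (pivot (Suc (Suc s)) v - 3)
     = of_bool (even s) * 2 ^ Suc (Suc s) + of_bool (odd s) * 2 ^ Suc s
       + height g (Suc s) (pivot s v - 1)"
proof -
  have "thue_morse (pivot (Suc s) v - 2) = (g = even s)"
    using g by (simp only: pivot_shift) (simp add: thue_morse_before_pivot del: One_nat_def)
  then show ?thesis
    by (simp only: pivot_shift(3) height_double height_pivot_minus_2) auto
qed

lemma pivot_div:
  "pivot s v div 2 ^ Suc s = v"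
  "(pivot s v - 1) div 2 ^ Suc s = v"
  "(pivot (Suc s) v - 2) div 2 ^ Suc (Suc s) = v"
  "(pivot (Suc s) v + 1) div 2 ^ Suc (Suc s) = v"
  "(pivot (Suc (Suc s)) v - 3) div 2 ^ Suc (Suc (Suc s)) = v"
  "(pivot (Suc (Suc s)) v + 2) div 2 ^ Suc (Suc (Suc s)) = v"
  "(pivot (Suc (Suc s)) v + 3) div 2 ^ Suc (Suc (Suc s)) = v"
proof -
  have e: "x div d = v" if "d * v \<le> x" "x < d * v + d" for x d :: nat
    using that by (intro div_nat_eqI) (simp_all add: mult.commute)
  define u w where "u = (2::nat) ^ s" and "w = 2 ^ s * v"
  have u: "1 \<le> u" by (simp add: u_def)
  have pw: "(2::nat) ^ Suc s = 2 * u" "(2::nat) ^ Suc (Suc s) = 4 * u"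
    "(2::nat) ^ Suc (Suc (Suc s)) = 8 * u"
    "2 * u * v = 2 * w" "4 * u * v = 4 * w" "8 * u * v = 8 * w"
    by (simp_all add: u_def w_def)
  have pv: "pivot s v = 2 * w + u" "pivot (Suc s) v = 4 * w + 2 * u"
    "pivot (Suc (Suc s)) v = 8 * w + 4 * u"
    by (simp_all add: pivot_def u_def w_def algebra_simps)
  show "pivot s v div 2 ^ Suc s = v"
    "(pivot s v - 1) div 2 ^ Suc s = v"
    "(pivot (Suc s) v - 2) div 2 ^ Suc (Suc s) = v"
    "(pivot (Suc s) v + 1) div 2 ^ Suc (Suc s) = v"
    "(pivot (Suc (Suc s)) v - 3) div 2 ^ Suc (Suc (Suc s)) = v"
    "(pivot (Suc (Suc s)) v + 2) div 2 ^ Suc (Suc (Suc s)) = v"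
    "(pivot (Suc (Suc s)) v + 3) div 2 ^ Suc (Suc (Suc s)) = v"
    unfolding pv pw(1-3) using u by (intro e; simp only: pw(4-6); linarith)+
qed

text \<open>With \<open>l'\<close> further digits the heights are scaled by \<open>E = 2 ^ l'\<close> and shifted by the common amount
  \<open>\<tau>\<close>. All residues that matter become linear expressions in \<open>H\<close>, \<open>E\<close> and \<open>\<tau>\<close>, which makes the
  case analysis below linear arithmetic.\<close>

lemma residues:
  assumes l: "l = Suc s + l'"
  defines "H \<equiv> (2::int) ^ l" and "E \<equiv> (2::int) ^ l'" and "\<tau> \<equiv> int (height g l' v)"
  defines "\<kappa> \<equiv> int (height g l (pivot s v))" and "\<theta> \<equiv> int (height g l (pivot s v - 1))"
  shows "\<kappa> = H - E + \<tau>"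
    and "3 * \<theta> = (if even s then H else 2 * H) - 2 * E + 3 * \<tau>"
    and "1 \<le> s \<Longrightarrow> 2 * int (height g l (pivot s v + 1)) = 2 * \<kappa> - H"
    and "1 \<le> s \<Longrightarrow> 2 * int (height g l (pivot s v - 2)) = 2 * \<theta> + (if even s then H else - H)"
    and "2 \<le> s \<Longrightarrow> 4 * int (height g l (pivot s v + 2)) = 4 * \<kappa> - 3 * H"
    and "2 \<le> s \<Longrightarrow> 4 * int (height g l (pivot s v + 3)) = 4 * \<kappa> - H"
    and "2 \<le> s \<Longrightarrow> 4 * int (height g l (pivot s v - 3)) = 4 * \<theta> + (if even s then H else - H)"
    and "H = E * 2 ^ Suc s" "0 \<le> \<tau>" "\<tau> < E"
proof -
  have split: "int (height g l n) = E * int (height g (Suc s) n) + \<tau>" if "n div 2 ^ Suc s = v" for n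
    unfolding l height_add that E_def \<tau>_def by simp
  have H: "H = E * 2 ^ Suc s" by (simp add: H_def E_def l power_add)
  then show "H = E * 2 ^ Suc s" .
  show "0 \<le> \<tau>" by (simp add: \<tau>_def)
  show "\<tau> < E" unfolding \<tau>_def E_def by (rule int_height_less)
  have sc: "E * (x + 1) = E * y \<Longrightarrow> E * x = E * y - E" for x y
    by (simp add: algebra_simps)
  have "int (height g (Suc s) (pivot s v)) + 1 = 2 ^ Suc s"
    using height_pivot [of s] by (metis of_nat_1 of_nat_add of_nat_numeral of_nat_power)
  then have "E * (int (height g (Suc s) (pivot s v)) + 1) = H" unfolding H by simp
  then show \<kappa>: "\<kappa> = H - E + \<tau>"
    unfolding \<kappa>_def split [OF pivot_div(1)] by (simp add: algebra_simps)
  have "3 * int (height g (Suc s) (pivot s v - 1)) + 2 = 2 ^ Suc s * (if even s then 1 else 2)"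
    using arg_cong [OF height_pivot_minus_1 [of s], of int]
    by (simp del: height.simps One_nat_def split: if_splits)
  then have "E * (3 * int (height g (Suc s) (pivot s v - 1)) + 2) = H * (if even s then 1 else 2)"
    unfolding H by simp
  then show "3 * \<theta> = (if even s then H else 2 * H) - 2 * E + 3 * \<tau>"
    unfolding \<theta>_def split [OF pivot_div(2)] by (simp add: algebra_simps split: if_splits)
  {
    assume "1 \<le> s"
    then obtain r where r: "s = Suc r" by (cases s) auto
    have "2 * int (height g (Suc s) (pivot s v + 1)) + 2 = 2 ^ Suc s"
      using arg_cong [OF height_pivot_plus_1 [of r], of int] by (simp add: r del: height.simps)
    then have "E * (2 * int (height g (Suc s) (pivot s v + 1)) + 2) = H" unfolding H by simp
    then show "2 * int (height g l (pivot s v + 1)) = 2 * \<kappa> - H"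
      unfolding \<kappa> split [OF pivot_div(4) [of r, folded r]] by (simp add: algebra_simps)
    have "2 * int (height g (Suc s) (pivot s v - 2))
        = 2 * int (height g (Suc s) (pivot s v - 1)) + (if even s then 1 else -1) * 2 ^ Suc s"
      unfolding r height_pivot_minus_2 height_pivot_minus_1_Suc by (auto simp del: height.simps)
    then have "E * (2 * int (height g (Suc s) (pivot s v - 2)))
        = E * (2 * int (height g (Suc s) (pivot s v - 1))) + (if even s then 1 else -1) * H"
      unfolding H by (simp add: algebra_simps)
    then show "2 * int (height g l (pivot s v - 2)) = 2 * \<theta> + (if even s then H else - H)"
      unfolding \<theta>_def split [OF pivot_div(2)] split [OF pivot_div(3) [of r, folded r]]
      by (simp add: algebra_simps split: if_splits)
  }
  {
    assume "2 \<le> s"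
    then obtain r where r: "s = Suc (Suc r)" by (metis add_2_eq_Suc le_Suc_ex)
    have "4 * int (height g (Suc s) (pivot s v + 2)) + 4 = 2 ^ Suc s"
      using arg_cong [OF height_pivot_plus_2 [of r], of int] by (simp add: r del: height.simps)
    then have "E * (4 * int (height g (Suc s) (pivot s v + 2)) + 4) = H" unfolding H by simp
    then show "4 * int (height g l (pivot s v + 2)) = 4 * \<kappa> - 3 * H"
      unfolding \<kappa> split [OF pivot_div(6) [of r, folded r]] by (simp add: algebra_simps)
    have "4 * int (height g (Suc s) (pivot s v + 3)) + 4 = 3 * 2 ^ Suc s"
      using arg_cong [OF height_pivot_plus_3 [of r], of int] by (simp add: r del: height.simps)
    then have "E * (4 * int (height g (Suc s) (pivot s v + 3)) + 4) = 3 * H" unfolding H by simp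
    then show "4 * int (height g l (pivot s v + 3)) = 4 * \<kappa> - H"
      unfolding \<kappa> split [OF pivot_div(7) [of r, folded r]] by (simp add: algebra_simps)
    have "4 * int (height g (Suc s) (pivot s v - 3))
        = 4 * int (height g (Suc s) (pivot s v - 1)) + (if even s then 1 else -1) * 2 ^ Suc s"
      unfolding r height_pivot_minus_3 height_pivot_minus_1_Suc by (auto simp del: height.simps)
    then have "E * (4 * int (height g (Suc s) (pivot s v - 3)))
        = E * (4 * int (height g (Suc s) (pivot s v - 1))) + (if even s then 1 else -1) * H"
      unfolding H by (simp add: algebra_simps)
    then show "4 * int (height g l (pivot s v - 3)) = 4 * \<theta> + (if even s then H else - H)"
      unfolding \<theta>_def split [OF pivot_div(2)] split [OF pivot_div(5) [of r, folded r]]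
      by (simp add: algebra_simps split: if_splits)
  }
qed

end

section \<open>Empty boxes around a pivot\<close>

text \<open>The left edge \<open>a\<close> and the lower edge \<open>c\<close> are excluded, so that each edge of a maximal empty box
  is the coordinate of a point of the net or lies on the boundary of the square.\<close>

definition empty_box :: "bool \<Rightarrow> nat \<Rightarrow> int \<Rightarrow> int \<Rightarrow> int \<Rightarrow> int \<Rightarrow> bool" where
  "empty_box g m a b c d \<longleftrightarrow>
     (\<forall>n. a < int n \<longrightarrow> int n < b \<longrightarrow> c < int (height g m n) \<longrightarrow> int (height g m n) < d \<longrightarrow> False)"

text \<open>The width is at most the fraction \<open>x / u\<close> of \<open>K\<close> and the height at most the fraction \<open>y / t\<close> of \<open>H\<close>;
  cross multiplication keeps all numbers integral.\<close>

lemma area_from_proportions: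
  fixes w h K H x y u t :: int
  assumes "0 \<le> w" "0 \<le> h" "0 \<le> K" "0 \<le> H" "u * w \<le> x * K" "t * h \<le> y * H" "2 * x * y \<le> 5 * u * t" "0 < u" "0 < t"
  shows "2 * w * h \<le> 5 * (K * H)"
proof -
  have "(u * w) * (t * h) \<le> (x * K) * (y * H)"
  proof (rule mult_mono [OF assms(5,6)])
    have "0 \<le> u * w" "0 \<le> t * h" using assms by simp_all
    then show "0 \<le> x * K" "0 \<le> t * h" using assms(5) by linarith+
  qed
  then have "(u * t) * (2 * w * h) \<le> (2 * x * y) * (K * H)"
    by (simp add: mult_ac)
  also have "\<dots> \<le> (5 * u * t) * (K * H)"
    using assms by (intro mult_right_mono) auto
  finally have "(u * t) * (2 * w * h) \<le> (u * t) * (5 * (K * H))"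
    by (simp add: mult_ac)
  then show ?thesis using assms by (simp add: mult_le_cancel_left)
qed

lemma spacing:
  fixes c d H r :: int
  assumes "0 < H" "\<And>i. \<lbrakk>c < H * i + r; H * i + r < d\<rbrakk> \<Longrightarrow> False"
  shows "d - c \<le> H"
proof -
  define i where "i = (c - r) div H + 1"
  have "H * ((c - r) div H) \<le> c - r" "c - r < H * ((c - r) div H) + H"
    using assms(1) pos_mod_bound [of H "c - r"] pos_mod_sign [of H "c - r"]
    by (simp_all add: minus_mod_eq_mult_div [symmetric])
  then have "c < H * i + r" "H * i + r \<le> c + H" by (simp_all add: i_def algebra_simps)
  moreover from this have "\<not> H * i + r < d" using assms(2) by blast
  ultimately show ?thesis by linarith
qed

lemma int_pow_ivl:
  fixes x :: int
  assumes "1 \<le> x"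
  obtains e where "2 ^ e \<le> x" "x < 2 * 2 ^ e"
proof -
  have "\<exists>e. 2 ^ e \<le> x \<and> x < 2 * 2 ^ e" using assms
  proof (induction "nat x" arbitrary: x rule: less_induct)
    case less
    show ?case
    proof (cases "x = 1")
      case True
      then show ?thesis by (intro exI [of _ 0]) simp
    next
      case False
      with less.prems have "1 \<le> x div 2" "nat (x div 2) < nat x" by auto
      with less.hyps obtain e where "2 ^ e \<le> x div 2" "x div 2 < 2 * 2 ^ e" by blast
      then have "2 ^ Suc e \<le> x \<and> x < 2 * 2 ^ Suc e" by auto
      then show ?thesis by blast
    qed
  qed
  with that show ?thesis by blast
qed

text \<open>The bounds \<open>left_le\<close> and \<open>right_le\<close> hold as soon as no integer strictly between \<open>a\<close> and \<open>b\<close> is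
  divisible by a higher power of two than the pivot. The value \<open>c = -1\<close> is admitted since it
  arises from \<open>d = 2 ^ m\<close> under reflection. The assumption on \<open>thue_morse v\<close> selects the
  orientation in which the digits at the pivot are ones.\<close>

locale empty_box_at_pivot =
  fixes g :: bool and m :: nat and a b c d :: int and p v :: nat
  assumes empty: "empty_box g m a b c d"
    and a_nonneg: "0 \<le> a" and b_le: "b \<le> 2 ^ m"
    and c_ge: "-1 \<le> c" and d_le: "d \<le> 2 ^ m" and c_less_d: "c < d"
    and tm: "thue_morse v = g"
    and a_less: "a < int (pivot p v)" and less_b: "int (pivot p v) < b"
    and left_le: "int (pivot p v) - a \<le> 2 ^ p" and right_le: "b - int (pivot p v) \<le> 2 ^ p"
begin

lemma no_point:
  "\<lbrakk>a < int n; int n < b; c < int (height g m n); int (height g m n) < d\<rbrakk> \<Longrightarrow> False"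
  using empty unfolding empty_box_def by blast

lemma column_block_point:
  assumes m: "m = k + l" and "c < 2 ^ l * i + int (height g l j)" "2 ^ l * i + int (height g l j) < d"
  shows "\<exists>n. n div 2 ^ k = j \<and> int (height g m n) = 2 ^ l * i + int (height g l j)"
  unfolding m
proof (rule height_surj_on_column_block)
  have "int (height g l j) < 2 ^ l" by (rule int_height_less)
  then show "(2 ^ l * i + int (height g l j)) mod 2 ^ l = int (height g l j)" by simp
  show "0 \<le> 2 ^ l * i + int (height g l j)" using assms(2) c_ge by linarith
  show "2 ^ l * i + int (height g l j) < 2 ^ (k + l)" using assms(3) d_le unfolding m by linarith
qed

lemma block_ivl:
  assumes "n div 2 ^ k = j"
  shows "2 ^ k * int j \<le> int n" "int n < 2 ^ k * int j + 2 ^ k"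
proof -
  have "2 ^ k * j \<le> n" "n < 2 ^ k * j + 2 ^ k"
    using assms dividend_less_div_times [of "2 ^ k" n] by (auto simp: mult.commute)
  then have "int (2 ^ k * j) \<le> int n" "int n < int (2 ^ k * j + 2 ^ k)"
    unfolding of_nat_le_iff of_nat_less_iff .
  then show "2 ^ k * int j \<le> int n" "int n < 2 ^ k * int j + 2 ^ k" by simp_all
qed

lemma column_block_avoid:
  assumes "m = k + l" "a < 2 ^ k * int j" "2 ^ k * int j + 2 ^ k \<le> b"
    and "c < 2 ^ l * i + int (height g l j)" "2 ^ l * i + int (height g l j) < d"
  shows False
proof -
  obtain n where n: "n div 2 ^ k = j" "int (height g m n) = 2 ^ l * i + int (height g l j)"
    using column_block_point [OF assms(1,4,5)] by blast
  have "a < int n" "int n < b" using block_ivl [OF n(1)] assms by linarith+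
  moreover have "c < int (height g m n)" "int (height g m n) < d"
    unfolding n(2) by (fact assms)+
  ultimately show False by (rule no_point)
qed

lemma column_block_spacing:
  assumes "m = k + l" "a < 2 ^ k * int j" "2 ^ k * int j + 2 ^ k \<le> b"
  shows "d - c \<le> 2 ^ l"
proof (rule spacing)
  show "(0::int) < 2 ^ l" by simp
  fix i
  assume "c < 2 ^ l * i + int (height g l j)" "2 ^ l * i + int (height g l j) < d"
  then show False by (rule column_block_avoid [OF assms])
qed

lemma same_row_dist:
  assumes m: "m = k + l"
    and "2 ^ l * q \<le> int (height g m n)" "int (height g m n) < 2 ^ l * q + 2 ^ l"
    and "2 ^ l * q \<le> int (height g m n')" "int (height g m n') < 2 ^ l * q + 2 ^ l"
  shows "2 ^ k dvd 2 * (int n - int n')"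
proof -
  have "int (height g k x) = q"
    if "2 ^ l * q \<le> int (height g m x)" "int (height g m x) < 2 ^ l * q + 2 ^ l" for x
  proof -
    have lt: "height g l (x div 2 ^ k) < 2 ^ l" by (rule height_less)
    have "height g k x = height g m x div 2 ^ l"
      using lt by (simp add: m height_add)
    then have "int (height g k x) = int (height g m x) div 2 ^ l"
      by (simp add: of_nat_div)
    also have "\<dots> = q"
      using that by (intro int_div_pos_eq [where r = "int (height g m x) - 2 ^ l * q"]) auto
    finally show ?thesis .
  qed
  from this [OF assms(2,3)] this [OF assms(4,5)] have "height g k n = height g k n'" by simp
  then show ?thesis by (rule height_eq_imp_cong)
qed

text \<open>Points at heights inside the box, but in blocks left and right of the pivot, must lie outside
  the box horizontally; hence their distance \<open>D\<close> bounds the width, and by the row property \<open>D\<close> is a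
  multiple of a large power of two whenever both heights lie in one row.\<close>

lemma width_by_witnesses:
  assumes m: "m = k + l"
    and hL: "hL = 2 ^ l * iL + int (height g l jL)" "c < hL" "hL < d"
    and hR: "hR = 2 ^ l * iR + int (height g l jR)" "c < hR" "hR < d"
    and pos: "2 ^ k * int jL + 2 ^ k \<le> int (pivot p v)" "int (pivot p v) \<le> 2 ^ k * int jR"
  obtains D :: int where "b - a \<le> D" "D < 2 ^ k * int jR + 2 ^ k - 2 ^ k * int jL"
    "\<And>k' l' q. \<lbrakk>m = k' + l'; 2 ^ l' * q \<le> hL; hL < 2 ^ l' * q + 2 ^ l';
        2 ^ l' * q \<le> hR; hR < 2 ^ l' * q + 2 ^ l'\<rbrakk> \<Longrightarrow> 2 ^ k' dvd 2 * D"
proof -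
  obtain nL where nL: "nL div 2 ^ k = jL" "int (height g m nL) = hL"
    using column_block_point [OF m] hL by blast
  obtain nR where nR: "nR div 2 ^ k = jR" "int (height g m nR) = hR"
    using column_block_point [OF m] hR by blast
  note L = block_ivl [OF nL(1)] and R = block_ivl [OF nR(1)]
  have "int nL < b" using L pos less_b by linarith
  then have "\<not> a < int nL" using no_point [of nL] hL(2,3) unfolding nL(2) by blast
  have "a < int nR" using R pos a_less by linarith
  then have "\<not> int nR < b" using no_point [of nR] hR(2,3) unfolding nR(2) by blast
  show ?thesis
  proof (rule that [of "int nR - int nL"])
    show "b - a \<le> int nR - int nL" using \<open>\<not> a < int nL\<close> \<open>\<not> int nR < b\<close> by linarith
    show "int nR - int nL < 2 ^ k * int jR + 2 ^ k - 2 ^ k * int jL" using L R by linarith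
    show "2 ^ k' dvd 2 * (int nR - int nL)"
      if "m = k' + l'" "2 ^ l' * q \<le> hL" "hL < 2 ^ l' * q + 2 ^ l'"
        "2 ^ l' * q \<le> hR" "hR < 2 ^ l' * q + 2 ^ l'" for k' l' q
      using same_row_dist [OF that(1)] that nL(2) nR(2) by blast
  qed
qed

lemma p_less_m: "p < m"
proof -
  have "(2::nat) ^ p \<le> pivot p v" by (simp add: pivot_def)
  then have "(2::int) ^ p \<le> int (pivot p v)"
    using of_nat_mono by fastforce
  then have "(2::int) ^ p < 2 ^ m" using less_b b_le by linarith
  then show ?thesis by simp
qed

lemma pivot_scale: "int (pivot (k + s) v) = 2 ^ k * int (pivot s v)"
  by (simp add: pivot_def power_add algebra_simps)

text \<open>A block of \<open>2 ^ e\<close> columns next to the pivot is dyadic, since \<open>e \<le> p\<close>.\<close>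

lemma right_spacing:
  assumes "2 ^ e \<le> b - int (pivot p v)"
  shows "2 ^ e * (d - c) \<le> 2 ^ m"
proof -
  have "(2::int) ^ e \<le> 2 ^ p" using assms right_le by linarith
  then have "e \<le> p" by simp
  then obtain s where s: "p = e + s" using le_Suc_ex by blast
  obtain l where l: "m = e + l" using p_less_m s by (metis add.assoc less_imp_add_positive)
  have e: "2 ^ e * int (pivot s v) = int (pivot p v)" by (simp add: s pivot_scale)
  have "d - c \<le> 2 ^ l"
    by (rule column_block_spacing [OF l, of "pivot s v"]; unfold e; use assms a_less in linarith)
  then show ?thesis by (simp add: l power_add)
qed

lemma left_spacing:
  assumes "2 ^ e < int (pivot p v) - a"
  shows "2 ^ e * (d - c) \<le> 2 ^ m"
proof -
  have "(2::int) ^ e \<le> 2 ^ p" using assms left_le by linarith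
  then have "e \<le> p" by simp
  then obtain s where s: "p = e + s" using le_Suc_ex by blast
  obtain l where l: "m = e + l" using p_less_m s by (metis add.assoc less_imp_add_positive)
  have "int (pivot s v - 1) = int (pivot s v) - 1" using pivot_pos [of s v] by simp
  then have e: "2 ^ e * int (pivot s v - 1) = int (pivot p v) - 2 ^ e"
    by (simp add: s pivot_scale right_diff_distrib)
  have "d - c \<le> 2 ^ l"
    by (rule column_block_spacing [OF l, of "pivot s v - 1"]; unfold e; use assms less_b in linarith)
  then show ?thesis by (simp add: l power_add)
qed

end

section \<open>Boxes of comparable extent on both sides of the pivot\<close>

lemma less_imp_le_multiple:
  fixes D K :: int
  assumes "0 < K" "K dvd D" "D < (n + 1) * K"
  shows "D \<le> n * K"
proof -
  obtain q where q: "D = K * q" using assms(2) ..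
  then have "q < n + 1" using assms by (simp add: mult.commute)
  then show ?thesis using assms(1) q by (simp add: mult.commute)
qed

text \<open>Now \<open>K = 2 ^ k\<close> is the unit of width and \<open>H = 2 ^ m / K\<close> the unit of height; the box contains
  the blocks of \<open>K\<close> columns on both sides of the pivot. Blocks are numbered relative to the pivot:
  block \<open>i\<close> consists of the \<open>K\<close> columns from \<open>X + K * i\<close> on, and \<open>res i\<close> is the residue of its heights
  modulo \<open>H\<close>.\<close>

locale empty_box_at_scale = empty_box_at_pivot +
  fixes k s l' :: nat
  assumes p: "p = k + s" and s: "1 \<le> s" and m: "m = k + (Suc s + l')"
    and left: "2 ^ k < int (pivot p v) - a" and right: "2 ^ k \<le> b - int (pivot p v)"
begin

definition "K = (2::int) ^ k"
definition "H = (2::int) ^ (Suc s + l')"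
definition "E = (2::int) ^ l'"
definition "X = int (pivot p v)"
definition "\<tau> = int (height g l' v)"

definition res :: "int \<Rightarrow> int" where
  "res i = int (height g (Suc s + l') (nat (int (pivot s v) + i)))"

lemma pos: "0 < K" "0 < H" "0 < E"
  and KH: "2 ^ m = K * H"
  by (simp_all add: K_def H_def E_def m power_add)

lemma H_ge_E: "s = 1 \<Longrightarrow> H = 4 * E" "2 \<le> s \<Longrightarrow> 8 * E \<le> H" "3 \<le> s \<Longrightarrow> 16 * E \<le> H"
proof -
  have H: "H = E * 2 ^ Suc s" by (simp add: H_def E_def power_add)
  have *: "2 ^ t * E \<le> H" if "t \<le> Suc s" for t
    unfolding H using power_increasing [OF that, of "2::int"] pos(3) by (simp add: mult.commute)
  show "2 \<le> s \<Longrightarrow> 8 * E \<le> H" "3 \<le> s \<Longrightarrow> 16 * E \<le> H"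
    using * [of 3] * [of 4] by simp_all
  show "s = 1 \<Longrightarrow> H = 4 * E" unfolding H by simp
qed

lemma pivot_ge_2: "2 \<le> pivot s v"
proof -
  have "2 ^ 1 \<le> (2::nat) ^ s" using s by (rule power_increasing) simp
  also have "\<dots> \<le> pivot s v" by (simp add: pivot_def)
  finally show ?thesis by simp
qed

lemma X_eq: "K * int (pivot s v) = X"
  unfolding X_def K_def by (simp add: p pivot_scale)

lemma tau_bounds: "0 \<le> \<tau>" "\<tau> < E"
  unfolding \<tau>_def E_def by (simp, rule int_height_less)

lemma res_bounds: "0 \<le> res i" "res i < H"
  unfolding res_def H_def by (simp, rule int_height_less)

lemma res_eqs:
  shows res_0: "res 0 = H - E + \<tau>"
    and res_1: "2 * res 1 = 2 * res 0 - H"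
    and res_2: "2 \<le> s \<Longrightarrow> 4 * res 2 = 4 * res 0 - 3 * H"
    and res_3: "2 \<le> s \<Longrightarrow> 4 * res 3 = 4 * res 0 - H"
    and res_m1: "3 * res (-1) = (if even s then H else 2 * H) - 2 * E + 3 * \<tau>"
    and res_m2: "2 * res (-2) = 2 * res (-1) + (if even s then H else - H)"
    and res_m3: "2 \<le> s \<Longrightarrow> 4 * res (-3) = 4 * res (-1) + (if even s then H else - H)"
proof -
  have n: "nat (int (pivot s v)) = pivot s v" "nat (int (pivot s v) + 1) = pivot s v + 1"
    "nat (int (pivot s v) + 2) = pivot s v + 2" "nat (int (pivot s v) + 3) = pivot s v + 3"
    "nat (int (pivot s v) - 1) = pivot s v - 1" "nat (int (pivot s v) - 2) = pivot s v - 2"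
    "nat (int (pivot s v) - 3) = pivot s v - 3"
    by linarith+
  note r = residues [OF tm, of "Suc s + l'" s l', OF refl, folded H_def E_def \<tau>_def]
  show "res 0 = H - E + \<tau>" "2 * res 1 = 2 * res 0 - H"
    "3 * res (-1) = (if even s then H else 2 * H) - 2 * E + 3 * \<tau>"
    "2 * res (-2) = 2 * res (-1) + (if even s then H else - H)"
    using r(1-4) s by (simp_all only: res_def n add_0_right add_uminus_conv_diff)
  assume "2 \<le> s"
  then show "4 * res 2 = 4 * res 0 - 3 * H" "4 * res 3 = 4 * res 0 - H"
    "4 * res (-3) = 4 * res (-1) + (if even s then H else - H)"
    using r(5-7) by (simp_all only: res_def n add_0_right add_uminus_conv_diff)
qed

lemma block_avoid:
  assumes "a < X + K * i" "X + K * i + K \<le> b"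
  shows "H * t + res i \<le> c \<or> d \<le> H * t + res i"
proof (rule ccontr)
  assume *: "\<not> ?thesis"
  have e: "K * (int (pivot s v) + i) = X + K * i" by (simp add: distrib_left X_eq)
  then have "0 < K * (int (pivot s v) + i)" using assms a_nonneg by linarith
  then have "0 < int (pivot s v) + i" using pos(1) by (simp add: zero_less_mult_iff)
  with e have e': "2 ^ k * int (nat (int (pivot s v) + i)) = X + K * i"
    by (simp add: K_def)
  show False
    by (rule column_block_avoid [OF m, of "nat (int (pivot s v) + i)" t])
       (use * assms in \<open>unfold e', auto simp: res_def H_def K_def\<close>)
qed

text \<open>The distance of the two witnesses is less than \<open>(j - i + 1) * K\<close>. It is a multiple of \<open>K / 2\<close>, and
  even of \<open>K\<close> if the witnesses share a row of height \<open>H / 2\<close>; this saves \<open>K / 2\<close> and \<open>K\<close>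
  respectively.\<close>

lemma width_from_points:
  assumes "0 \<le> int (pivot s v) + i" "i < 0" "0 \<le> j"
    and hL: "c < H * t + res i" "H * t + res i < d"
    and hR: "c < H * t + res j" "H * t + res j < d"
  shows same_row_width: "2 * (b - a) \<le> (2 * (j - i) + 1) * K"
    and same_half_row_width: "\<lbrakk>H = 2 * M; M * q \<le> H * t + res i; H * t + res i < M * q + M;
      M * q \<le> H * t + res j; H * t + res j < M * q + M\<rbrakk> \<Longrightarrow> b - a \<le> (j - i) * K"
proof -
  have e: "2 ^ k * int (nat (int (pivot s v) + x)) = X + K * x" if "0 \<le> int (pivot s v) + x" for x
    using that by (simp add: distrib_left X_eq flip: K_def)
  have j: "0 \<le> int (pivot s v) + j" using assms by simp
  have "K * (i + 1) \<le> 0" "0 \<le> K * j"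
    using assms pos(1) by (auto simp: mult_le_0_iff)
  then have pos': "2 ^ k * int (nat (int (pivot s v) + i)) + 2 ^ k \<le> int (pivot p v)"
    "int (pivot p v) \<le> 2 ^ k * int (nat (int (pivot s v) + j))"
    unfolding e [OF assms(1)] e [OF j] by (simp_all add: K_def X_def distrib_left)
  obtain D where D: "b - a \<le> D"
    "D < 2 ^ k * int (nat (int (pivot s v) + j)) + 2 ^ k - 2 ^ k * int (nat (int (pivot s v) + i))"
    and rows: "\<And>k' l' q. \<lbrakk>m = k' + l'; 2 ^ l' * q \<le> H * t + res i; H * t + res i < 2 ^ l' * q + 2 ^ l';
        2 ^ l' * q \<le> H * t + res j; H * t + res j < 2 ^ l' * q + 2 ^ l'\<rbrakk> \<Longrightarrow> 2 ^ k' dvd 2 * D"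
    by (rule width_by_witnesses [OF m _ hL _ hR pos', of t t])
       (simp_all only: res_def H_def)
  have D_less: "D < (j - i + 1) * K"
    using D(2) unfolding e [OF assms(1)] e [OF j] by (simp add: K_def algebra_simps)
  have "K dvd 2 * D"
    unfolding K_def
    by (rule rows [OF m, of t]; fold H_def; use res_bounds [of i] res_bounds [of j] in linarith)
  moreover have "2 * D < (2 * (j - i) + 1 + 1) * K"
    using D_less by (simp add: algebra_simps)
  ultimately have "2 * D \<le> (2 * (j - i) + 1) * K" by (rule less_imp_le_multiple [OF pos(1)])
  moreover have "2 * (b - a) \<le> 2 * D" using D(1) by simp
  ultimately show "2 * (b - a) \<le> (2 * (j - i) + 1) * K" by (rule order_trans [rotated])
  assume M: "H = 2 * M" "M * q \<le> H * t + res i" "H * t + res i < M * q + M"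
      "M * q \<le> H * t + res j" "H * t + res j < M * q + M"
  from M(1) have M': "M = 2 ^ (s + l')" by (simp add: H_def)
  have "2 ^ Suc k dvd 2 * D"
    using M(2-) m unfolding M' by (intro rows [of _ "s + l'" q]) simp_all
  then have "K dvd D" by (simp add: K_def)
  from less_imp_le_multiple [OF pos(1) this D_less] D(1)
  show "b - a \<le> (j - i) * K" by (rule order_trans [rotated])
qed

text \<open>The heights \<open>H * t + res 0\<close> of block \<open>0\<close> cut the box to one period, which serves as the frame for
  the other residues.\<close>

lemma period:
  obtains t where "H * t + res 0 \<le> c + H" "c < H * t + res 0" "d \<le> H * t + res 0"
proof -
  define t where "t = (c - res 0) div H + 1"
  have "H * ((c - res 0) div H) \<le> c - res 0" "c - res 0 < H * ((c - res 0) div H) + H"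
    using pos(2) pos_mod_bound [of H "c - res 0"] pos_mod_sign [of H "c - res 0"]
    by (simp_all add: minus_mod_eq_mult_div [symmetric])
  then have "H * t + res 0 \<le> c + H" "c < H * t + res 0" by (simp_all add: t_def algebra_simps)
  moreover have "H * t + res 0 \<le> c \<or> d \<le> H * t + res 0"
    using block_avoid [of 0 t] a_less right by (simp add: X_def K_def)
  ultimately show ?thesis using that [of t] by linarith
qed

lemma avoid_m1: "H * t + res (-1) \<le> c \<or> d \<le> H * t + res (-1)"
  using block_avoid [of "-1" t] less_b left by (simp add: X_def K_def)

text \<open>A box of height at most \<open>5 / 8 H\<close> is harmless since its width is at most \<open>4 K\<close>. The blocks \<open>-1\<close>
  and \<open>0\<close> leave one larger gap per period: \<open>3 / 4 H\<close> if \<open>s = 1\<close>, and about \<open>2 / 3 H\<close>, at most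
  \<open>11 / 16 H\<close>, otherwise. A box in this gap that is higher than \<open>5 / 8 H\<close> contains heights of points
  of the blocks \<open>-2\<close> and \<open>1\<close>. These lie in one row, and for \<open>s = 1\<close> in one half of it, so the width
  is at most \<open>7 / 2 K\<close>, and \<open>3 K\<close> for \<open>s = 1\<close>.\<close>

lemma narrow_case:
  assumes "X - a \<le> 2 * K" "b - X < 2 * K"
  shows "2 * (b - a) * (d - c) \<le> 5 * 2 ^ m"
proof -
  have w: "b - a \<le> 4 * K" "0 \<le> b - a" and h: "0 \<le> d - c"
    using assms c_less_d a_less less_b by linarith+
  obtain t where c: "H * t + res 0 \<le> c + H" "c < H * t + res 0" and d: "d \<le> H * t + res 0"
    using period .
  note area = area_from_proportions [OF w(2) h less_imp_le [OF pos(1)] less_imp_le [OF pos(2)], folded KH]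
  have points: "if s = 1 then b - a \<le> 3 * K else 2 * (b - a) \<le> 7 * K"
    if in_box: "c < H * t + res (-2)" "H * t + res (-2) < d" "c < H * t + res 1" "H * t + res 1 < d"
  proof -
    have nonneg: "0 \<le> int (pivot s v) + - 2" using pivot_ge_2 by simp
    show ?thesis
    proof (cases "s = 1")
      case True
      have half: "H = 2 * (2 * E)" using H_ge_E(1) [OF True] by simp
      have e: "2 * E * (2 * t) = H * t" using H_ge_E(1) [OF True] by simp
      have "b - a \<le> (1 - (- 2)) * K"
        by (rule same_half_row_width [OF nonneg _ _ in_box half, of "2 * t"]; (unfold e)?)
           (use half tau_bounds res_0 res_1 res_m1 res_m2 True in simp_all)
      with True show ?thesis by simp
    next
      case False
      then show ?thesis using same_row_width [OF nonneg _ _ in_box] by simp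
    qed
  qed
  have "8 * (d - c) \<le> 5 * H \<or>
    (c < H * t + res (-2) \<and> H * t + res (-2) < d \<and> c < H * t + res 1 \<and> H * t + res 1 < d \<and>
      (if s = 1 then 4 * (d - c) \<le> 3 * H else 16 * (d - c) \<le> 11 * H))"
  proof (cases "even s")
    case True
    then have "2 \<le> s" using s by presburger
    then show ?thesis
      using True avoid_m1 [of t] c d H_ge_E(2) tau_bounds res_0 res_1 res_m1 res_m2 by (smt (verit))
  next
    case False
    show ?thesis
    proof (cases "s = 1")
      case True
      then show ?thesis
        using False avoid_m1 [of t] c d H_ge_E(1) tau_bounds res_0 res_1 res_m1 res_m2 by (smt (verit))
    next
      case 1: False
      then have "3 \<le> s" using s False by presburger
      then show ?thesis
        using 1 False avoid_m1 [of t] c d H_ge_E(3) tau_bounds res_0 res_1 res_m1 res_m2 by (smt (verit))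
    qed
  qed
  then show ?thesis
  proof (elim disjE conjE)
    assume "8 * (d - c) \<le> 5 * H"
    then show ?thesis using w by (intro area [of 1 4 8 5]) auto
  next
    assume "c < H * t + res (-2)" "H * t + res (-2) < d" "c < H * t + res 1" "H * t + res 1 < d"
      and h: "if s = 1 then 4 * (d - c) \<le> 3 * H else 16 * (d - c) \<le> 11 * H"
    then consider "b - a \<le> 3 * K" "4 * (d - c) \<le> 3 * H" | "2 * (b - a) \<le> 7 * K" "16 * (d - c) \<le> 11 * H"
      using points by presburger
    then show ?thesis
    proof cases
      case 1
      then show ?thesis by (intro area [of 1 3 4 3]) auto
    next
      case 2
      then show ?thesis by (intro area [of 2 7 16 11]) auto
    qed
  qed
qed

text \<open>The blocks \<open>0\<close> and \<open>1\<close> leave gaps of \<open>H / 2\<close>. Block \<open>2\<close> splits one of the two gaps in each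
  period, and block \<open>-1\<close> splits the other if \<open>s\<close> is odd; the remaining pieces are at most
  \<open>3 / 8 H\<close>. If \<open>s\<close> is even, a box in the unsplit gap that is higher than \<open>3 / 8 H\<close> contains
  heights of points of the blocks \<open>-2\<close> and \<open>3\<close>. These lie in the same half of a row, which limits the
  width to \<open>5 K\<close>. This case is sharp: \<open>5 K * H / 2\<close> is the extremal area.\<close>

lemma wide_right_case:
  assumes "2 \<le> s" "X - a \<le> 2 * K" "3 * K \<le> b - X" "b - X \<le> 4 * K"
  shows "2 * (b - a) * (d - c) \<le> 5 * 2 ^ m"
proof -
  have w: "b - a \<le> 6 * K" "0 \<le> b - a" and h: "0 \<le> d - c"
    using assms c_less_d a_less less_b by linarith+
  obtain t where c: "H * t + res 0 \<le> c + H" "c < H * t + res 0" and d: "d \<le> H * t + res 0"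
    using period .
  note area = area_from_proportions [OF w(2) h less_imp_le [OF pos(1)] less_imp_le [OF pos(2)], folded KH]
  have avoid: "H * t + res 1 \<le> c \<or> d \<le> H * t + res 1" "H * t + res 2 \<le> c \<or> d \<le> H * t + res 2"
    using block_avoid [of 1 t] block_avoid [of 2 t] assms a_less pos by (auto simp: X_def)
  have "8 * (d - c) \<le> 3 * H \<or>
    (c < H * t + res (-2) \<and> H * t + res (-2) < d \<and> c < H * t + res 3 \<and> H * t + res 3 < d \<and>
      even s \<and> 2 * (d - c) \<le> H)"
  proof (cases "even s")
    case True
    then show ?thesis
      using avoid c d H_ge_E(2) assms(1) tau_bounds res_0 res_1 res_2 res_3 res_m1 res_m2 by (smt (verit))
  next
    case False
    then have "3 \<le> s" using assms(1) by presburger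
    then show ?thesis
      using False avoid avoid_m1 [of t] c d H_ge_E(3) assms(1) tau_bounds res_0 res_1 res_2 res_m1 by (smt (verit))
  qed
  then show ?thesis
  proof (elim disjE conjE)
    assume "8 * (d - c) \<le> 3 * H"
    then show ?thesis using w by (intro area [of 1 6 8 3]) auto
  next
    assume in_box: "c < H * t + res (-2)" "H * t + res (-2) < d" "c < H * t + res 3" "H * t + res 3 < d"
      and "even s" and h: "2 * (d - c) \<le> H"
    have nonneg: "0 \<le> int (pivot s v) + - 2" using pivot_ge_2 by simp
    obtain M where M: "H = 2 * M" by (simp add: H_def)
    have e: "M * (2 * t + 1) = H * t + M" by (simp add: M algebra_simps)
    have "b - a \<le> (3 - (- 2)) * K"
      by (rule same_half_row_width [OF nonneg _ _ in_box M, of "2 * t + 1"]; (unfold e)?)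
         (use \<open>even s\<close> assms(1) M H_ge_E(2) tau_bounds res_0 res_3 res_m1 res_m2 res_bounds [of "-2"]
            res_bounds [of 3] in simp_all)
    then have "b - a \<le> 5 * K" by simp
    then show ?thesis using h by (intro area [of 1 5 2 1]) auto
  qed
qed

text \<open>Here the blocks \<open>-3\<close>, \<open>-2\<close>, \<open>-1\<close> and \<open>0\<close> already split every period into pieces of at most
  \<open>3 / 8 H\<close>.\<close>

lemma wide_left_case:
  assumes "2 \<le> s" "3 * K < X - a" "X - a \<le> 4 * K" "b - X \<le> 2 * K"
  shows "2 * (b - a) * (d - c) \<le> 5 * 2 ^ m"
proof -
  have w: "b - a \<le> 6 * K" "0 \<le> b - a" and h: "0 \<le> d - c"
    using assms c_less_d a_less less_b by linarith+
  obtain t where c: "H * t + res 0 \<le> c + H" "c < H * t + res 0" and d: "d \<le> H * t + res 0"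
    using period .
  note area = area_from_proportions [OF w(2) h less_imp_le [OF pos(1)] less_imp_le [OF pos(2)], folded KH]
  have avoid: "H * t + res (-2) \<le> c \<or> d \<le> H * t + res (-2)" "H * t + res (-3) \<le> c \<or> d \<le> H * t + res (-3)"
    using block_avoid [of "-2" t] block_avoid [of "-3" t] assms less_b pos by (auto simp: X_def)
  have "8 * (d - c) \<le> 3 * H"
  proof (cases "even s")
    case True
    then show ?thesis
      using avoid avoid_m1 [of t] c d H_ge_E(2) assms(1) tau_bounds res_0 res_m1 res_m2 res_m3 by (smt (verit))
  next
    case False
    then have "3 \<le> s" using assms(1) by presburger
    then show ?thesis
      using False avoid avoid_m1 [of t] c d H_ge_E(3) assms(1) tau_bounds res_0 res_m1 res_m2 res_m3 by (smt (verit))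
  qed
  then show ?thesis using w by (intro area [of 1 6 8 3]) auto
qed

end

section \<open>The area of an empty box\<close>

context empty_box_at_pivot
begin

lemma area_from_spacing:
  assumes "2 ^ e * (d - c) \<le> 2 ^ m" "2 * b - 2 * a \<le> 5 * 2 ^ e"
  shows "2 * (b - a) * (d - c) \<le> 5 * 2 ^ m"
proof -
  have "2 * (b - a) * (d - c) \<le> 5 * 2 ^ e * (d - c)"
    using assms(2) c_less_d by (intro mult_right_mono) (simp_all add: right_diff_distrib)
  with assms(1) show ?thesis by simp
qed

lemma at_scale:
  assumes "2 ^ k < int (pivot p v) - a" "2 ^ k \<le> b - int (pivot p v)"
  shows "empty_box_at_scale g m a b c d p v k (p - k) (m - Suc p)"
proof -
  have "(2::int) ^ k < 2 ^ p" using assms(1) left_le by linarith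
  then have "k < p" by simp
  then show "empty_box_at_scale g m a b c d p v k (p - k) (m - Suc p)"
    using assms p_less_m by unfold_locales auto
qed

text \<open>Let \<open>2 ^ e\<close> and \<open>2 ^ f\<close> be the sizes of the largest dyadic blocks that the box contains directly to
  the right and to the left of the pivot. If \<open>e\<close> and \<open>f\<close> differ by at least two, the larger block
  alone suffices: in units of its size the width is at most \<open>2 + 1 / 2\<close>. If they differ by one, it
  suffices as long as the longer side is at most three units of the smaller size.\<close>

lemma area: "2 * (b - a) * (d - c) \<le> 5 * 2 ^ m"
proof -
  define x where "x = int (pivot p v)"
  obtain e where e: "2 ^ e \<le> b - x" "b - x < 2 * 2 ^ e"
    using int_pow_ivl [of "b - x"] less_b unfolding x_def by auto
  note right = area_from_spacing [OF right_spacing [OF e(1) [unfolded x_def]]]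
  show ?thesis
  proof (cases "x - a = 1")
    case True
    \<comment> \<open>The box has no column to the left of the pivot.\<close>
    then have "b - a \<le> 2 * 2 ^ e" using e by linarith
    moreover have "(0::int) < 2 ^ e" by simp
    ultimately show ?thesis by (intro right) linarith
  next
    case False
    then have "1 \<le> x - a - 1" using a_less unfolding x_def by linarith
    then obtain f where "2 ^ f \<le> x - a - 1" "x - a - 1 < 2 * 2 ^ f" by (rule int_pow_ivl)
    then have f: "2 ^ f < x - a" "x - a \<le> 2 * 2 ^ f" by linarith+
    note left = area_from_spacing [OF left_spacing [OF f(1) [unfolded x_def]]]
    note scale = at_scale [folded x_def]
    have grow: "4 * 2 ^ i \<le> (2::int) ^ j" if "i + 2 \<le> j" for i j :: nat
      using power_increasing [OF that, of "2::int"] by (simp add: power_add)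
    consider "f = e" | "f + 2 \<le> e" | "e + 2 \<le> f" | "e = f + 1" | "f = e + 1" by linarith
    then show ?thesis
    proof cases
      case 1
      interpret empty_box_at_scale g m a b c d p v e "p - e" "m - Suc p"
        using f e 1 by (intro scale) auto
      show ?thesis
        using e f 1 by (intro narrow_case) (simp_all add: K_def X_def x_def)
    next
      case 2
      then show ?thesis using e(2) f(2) grow [OF 2] by (intro right) linarith
    next
      case 3
      then show ?thesis using e(2) f(2) grow [OF 3] by (intro left) linarith
    next
      case 4
      show ?thesis
      proof (cases "b - x < 3 * 2 ^ f")
        case True
        then show ?thesis using f(2) 4 by (intro right) simp
      next
        case False
        have sc: "2 ^ f < x - a" "2 ^ f \<le> b - x" using f e 4 by simp_all
        interpret empty_box_at_scale g m a b c d p v f "p - f" "m - Suc p"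
          using sc by (rule scale)
        have "(0::int) < 2 ^ f" by simp
        then have "2 * (2::int) ^ f < 2 ^ p"
          using False right_le unfolding x_def [symmetric] by linarith
        then have "(2::int) ^ Suc f < 2 ^ p" by simp
        then have "Suc f < p" by (rule power_less_imp_less_exp [rotated]) simp
        then have "2 \<le> p - f" by simp
        then show ?thesis
          using False e f 4 by (intro wide_right_case) (simp_all add: K_def X_def x_def)
      qed
    next
      case 5
      show ?thesis
      proof (cases "x - a \<le> 3 * 2 ^ e")
        case True
        then show ?thesis using e(2) 5 by (intro left) simp
      next
        case False
        have sc: "2 ^ e < x - a" "2 ^ e \<le> b - x" using f e 5 by simp_all
        interpret empty_box_at_scale g m a b c d p v e "p - e" "m - Suc p"
          using sc by (rule scale)
        have "(0::int) < 2 ^ e" by simp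
        then have "2 * (2::int) ^ e < 2 ^ p"
          using False left_le unfolding x_def [symmetric] by linarith
        then have "(2::int) ^ Suc e < 2 ^ p" by simp
        then have "Suc e < p" by (rule power_less_imp_less_exp [rotated]) simp
        then have "2 \<le> p - e" by simp
        then show ?thesis
          using False e f 5 by (intro wide_left_case) (simp_all add: K_def X_def x_def)
      qed
    qed
  qed
qed

end

lemma empty_box_reflect:
  assumes "empty_box g m a b c d"
  shows "empty_box (\<not> g) m a b (2 ^ m - 1 - d) (2 ^ m - 1 - c)"
proof -
  have "int (height (\<not> g) m n) = 2 ^ m - 1 - int (height g m n)" for n
  proof -
    have "height g m n + height (\<not> g) m n + 1 = 2 ^ m"
      using height_complement [of g m n] by simp
    then have "int (height g m n + height (\<not> g) m n + 1) = int (2 ^ m)" by (simp only:)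
    then show ?thesis by simp
  qed
  with assms show ?thesis unfolding empty_box_def by auto
qed

text \<open>For an integer with the largest power \<open>2 ^ p\<close>, adding or subtracting \<open>2 ^ p\<close> gives a multiple of
  \<open>2 ^ Suc p\<close>, which therefore cannot lie strictly between \<open>a\<close> and \<open>b\<close>.\<close>

lemma exists_dominating_pivot:
  fixes a b :: int
  assumes "0 \<le> a" "a + 1 < b"
  obtains p v where "a < int (pivot p v)" "int (pivot p v) < b"
    "int (pivot p v) - a \<le> 2 ^ p" "b - int (pivot p v) \<le> 2 ^ p"
proof -
  define P where "P = (\<lambda>p. \<exists>q. a < 2 ^ p * q \<and> 2 ^ p * q < b)"
  have "P 0" using assms by (auto simp: P_def intro: exI [of _ "a + 1"])
  have bound: "p \<le> nat b" if Pp: "P p" for p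
  proof -
    obtain q where q: "a < 2 ^ p * q" "2 ^ p * q < b" using Pp unfolding P_def by blast
    then have "0 < (2 :: int) ^ p * q" using assms by linarith
    then have "1 \<le> q" by (simp add: zero_less_mult_iff)
    then have "(2::int) ^ p * 1 \<le> 2 ^ p * q" by (intro mult_left_mono) auto
    then have "2 ^ p < b" using q by linarith
    moreover have "int p < 2 ^ p" using of_nat_less_two_power [of p, where 'a = int] by simp
    ultimately show ?thesis by linarith
  qed
  define p where "p = (GREATEST p. P p)"
  have "P p" unfolding p_def using \<open>P 0\<close> bound by (rule GreatestI_nat)
  then obtain q where q: "a < 2 ^ p * q" "2 ^ p * q < b" unfolding P_def by blast
  have max: "\<not> P (Suc p)"
  proof
    assume "P (Suc p)"
    then have "Suc p \<le> p" unfolding p_def using bound by (rule Greatest_le_nat)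
    then show False by simp
  qed
  have "odd q"
  proof
    assume "even q"
    then obtain r where "q = 2 * r" ..
    then have "P (Suc p)" using q unfolding P_def by (intro exI [of _ r]) (simp add: mult_ac)
    with max show False ..
  qed
  moreover have "0 < q"
  proof -
    have "0 < 2 ^ p * q" using q(1) assms(1) by linarith
    then show ?thesis by (simp add: zero_less_mult_iff)
  qed
  ultimately have "q = 2 * int (nat (q div 2)) + 1"
    by (simp add: pos_imp_zdiv_nonneg_iff odd_two_times_div_two_succ)
  then obtain v where v: "q = 2 * int v + 1" ..
  have pv: "int (pivot p v) = 2 ^ p * q" unfolding pivot_def v by (simp add: algebra_simps)
  have no: "\<not> (a < 2 ^ Suc p * r \<and> 2 ^ Suc p * r < b)" for r
    using max unfolding P_def by blast
  have "2 ^ Suc p * int v = 2 ^ p * q - 2 ^ p" "2 ^ Suc p * (int v + 1) = 2 ^ p * q + 2 ^ p"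
    by (simp_all add: v algebra_simps)
  moreover have "(0::int) < 2 ^ p" by simp
  ultimately show ?thesis
    using q no [of "int v"] no [of "int v + 1"] by (intro that [of p v]; unfold pv; linarith)
qed

lemma empty_box_area:
  assumes "empty_box g m a b c d" "0 \<le> a" "b \<le> 2 ^ m" "-1 \<le> c" "d \<le> 2 ^ m" "a < b" "c < d"
  shows "2 * (b - a) * (d - c) \<le> 5 * 2 ^ m"
proof (cases "a + 1 < b")
  case True
  then obtain p v where pv: "a < int (pivot p v)" "int (pivot p v) < b"
    "int (pivot p v) - a \<le> 2 ^ p" "b - int (pivot p v) \<le> 2 ^ p"
    using exists_dominating_pivot assms(2) by metis
  show ?thesis
  proof (cases "thue_morse v = g")
    case True
    interpret empty_box_at_pivot g m a b c d p v
      using assms pv True by unfold_locales auto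
    show ?thesis by (rule area)
  next
    case False
    \<comment> \<open>In the other orientation the reflected box is considered.\<close>
    interpret empty_box_at_pivot "\<not> g" m a b "2 ^ m - 1 - d" "2 ^ m - 1 - c" p v
      using assms empty_box_reflect [OF assms(1)] pv False by unfold_locales auto
    show ?thesis using area by simp
  qed
next
  case False
  then have "b - a = 1" using assms by linarith
  moreover have "(1::int) \<le> 2 ^ m" by simp
  ultimately show ?thesis using assms by simp
qed

section \<open>The points of the net\<close>

lemma thue_morse_sum_digits:
  "n < 2 ^ r \<Longrightarrow> (\<Sum>j<r. of_nat (n div 2 ^ j mod 2)) = (of_bool (thue_morse n) :: bit)"
proof (induction r arbitrary: n)
  case (Suc r)
  have "(\<Sum>j<Suc r. of_nat (n div 2 ^ j mod 2) :: bit)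
      = of_nat (n mod 2) + (\<Sum>j<r. of_nat (n div 2 div 2 ^ j mod 2))"
    by (simp add: sum.lessThan_Suc_shift div_mult2_eq del: sum.lessThan_Suc)
  also have "\<dots> = of_nat (n mod 2) + of_bool (thue_morse (n div 2))"
    using Suc.IH [of "n div 2"] Suc.prems by simp
  also have "\<dots> = of_bool (thue_morse n)"
    by (subst (2) thue_morse.simps) (auto simp: mod2_eq_if)
  finally show ?case .
qed simp

lemma height_eq_sum:
  "real (height False m n) / 2 ^ m = (\<Sum>i<m. of_bool (thue_morse (n div 2 ^ i)) / 2 ^ (i + 1))"
proof (induction m arbitrary: n)
  case (Suc m)
  have "(\<Sum>i<Suc m. of_bool (thue_morse (n div 2 ^ i)) / 2 ^ (i + 1) :: real)
      = of_bool (thue_morse n) / 2 + (\<Sum>i<m. of_bool (thue_morse (n div 2 div 2 ^ i)) / 2 ^ (i + 1)) / 2"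
    by (simp add: sum.lessThan_Suc_shift div_mult2_eq sum_divide_distrib mult.commute del: sum.lessThan_Suc)
  also have "\<dots> = of_bool (thue_morse n) / 2 + real (height False m (n div 2)) / 2 ^ m / 2"
    unfolding Suc.IH ..
  also have "\<dots> = real (height False (Suc m) n) / 2 ^ Suc m"
    by (simp add: field_simps)
  finally show ?case by simp
qed simp

lemma net_coord_U_mat:
  assumes "n < 2 ^ m"
  shows "net_coord m (U_mat m) n = real (height False m n) / 2 ^ m"
proof -
  have "vec_index (U_mat m *\<^sub>v digit_vec m n) i = of_bool (thue_morse (n div 2 ^ i))" if "i < m" for i
  proof -
    have "vec_index (U_mat m *\<^sub>v digit_vec m n) i
        = (\<Sum>j<m. (if i \<le> j then 1 else 0) * of_nat (n div 2 ^ j mod 2))"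
      using that by (simp add: U_mat_def digit_vec_def scalar_prod_def lessThan_atLeast0)
    also have "\<dots> = (\<Sum>j\<in>{i..<m}. of_nat (n div 2 ^ j mod 2))"
      by (intro sum.mono_neutral_cong_right) auto
    also have "\<dots> = (\<Sum>j<m - i. of_nat (n div 2 ^ i div 2 ^ j mod 2))"
      by (rule sum.reindex_bij_witness [of _ "\<lambda>j. j + i" "\<lambda>j. j - i"])
         (auto simp: div_mult2_eq [symmetric] power_add [symmetric])
    also have "\<dots> = of_bool (thue_morse (n div 2 ^ i))"
      using assms that
      by (intro thue_morse_sum_digits) (simp add: less_mult_imp_div_less power_add [symmetric])
    finally show ?thesis .
  qed
  then show ?thesis
    unfolding net_coord_def height_eq_sum by (intro sum.cong) auto
qed

lemma binary_expansion: "n < 2 ^ m \<Longrightarrow> (\<Sum>j<m. n div 2 ^ j mod 2 * 2 ^ j) = n" for n :: nat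
proof (induction m arbitrary: n)
  case (Suc m)
  have "(\<Sum>j<Suc m. n div 2 ^ j mod 2 * 2 ^ j)
      = n mod 2 + 2 * (\<Sum>j<m. n div 2 div 2 ^ j mod 2 * 2 ^ j)"
    by (simp add: sum.lessThan_Suc_shift div_mult2_eq sum_distrib_left mult_ac del: sum.lessThan_Suc)
  also have "\<dots> = n" using Suc.IH [of "n div 2"] Suc.prems by simp
  finally show ?case .
qed simp

lemma net_coord_J_mat:
  assumes "n < 2 ^ m"
  shows "net_coord m (J_mat m) n = real n / 2 ^ m"
proof -
  have "of_bit (vec_index (J_mat m *\<^sub>v digit_vec m n) i) / 2 ^ (i + 1)
      = real (n div 2 ^ (m - Suc i) mod 2 * 2 ^ (m - Suc i)) / 2 ^ m" if i: "i < m" for i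
  proof -
    have "vec_index (J_mat m *\<^sub>v digit_vec m n) i
        = (\<Sum>j<m. (if i + j + 1 = m then 1 else 0) * of_nat (n div 2 ^ j mod 2))"
      using i by (simp add: J_mat_def digit_vec_def scalar_prod_def lessThan_atLeast0)
    also have "\<dots> = (\<Sum>j\<in>{m - Suc i}. of_nat (n div 2 ^ j mod 2))"
      using i by (intro sum.mono_neutral_cong_right) auto
    finally have e: "vec_index (J_mat m *\<^sub>v digit_vec m n) i = of_nat (n div 2 ^ (m - Suc i) mod 2)"
      by simp
    have "(2::real) ^ m = 2 ^ (m - Suc i) * 2 ^ (i + 1)"
      using i power_add [of "2::real" "m - Suc i" "i + 1"] by simp
    then show ?thesis unfolding e by (simp add: mod2_eq_if)
  qed
  then have "net_coord m (J_mat m) n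
      = (\<Sum>i<m. real (n div 2 ^ (m - Suc i) mod 2 * 2 ^ (m - Suc i)) / 2 ^ m)"
    unfolding net_coord_def by (intro sum.cong) auto
  also have "\<dots> = (\<Sum>j<m. real (n div 2 ^ j mod 2 * 2 ^ j) / 2 ^ m)"
    by (rule sum.nat_diff_reindex)
  also have "\<dots> = real (\<Sum>j<m. n div 2 ^ j mod 2 * 2 ^ j) / 2 ^ m"
    by (simp only: of_nat_sum sum_divide_distrib)
  finally show ?thesis unfolding binary_expansion [OF assms] .
qed

abbreviation U_net :: "nat \<Rightarrow> (real \<times> real) set" where
  "U_net m \<equiv> digital_net m (J_mat m) (U_mat m)"

lemma U_net_eq:
  "U_net m = (\<lambda>n. (real n / 2 ^ m, real (height False m n) / 2 ^ m)) ` {..<2 ^ m}"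
proof -
  have "0 < (2::nat) ^ m" by simp
  then have iff: "x \<le> 2 ^ m - 1 \<longleftrightarrow> x < 2 ^ m" for x :: nat by linarith
  have range: "{0..2 ^ m - 1} = {..<2 ^ m :: nat}"
    using iff by (intro equalityI subsetI) simp_all
  show ?thesis
    unfolding digital_net_def range
    by (rule image_cong) (simp_all only: lessThan_iff net_coord_J_mat net_coord_U_mat)
qed

lemma measure_box:
  fixes x1 y1 x2 y2 :: real
  assumes "x1 \<le> y1" "x2 \<le> y2"
  shows "measure lborel ({x1..<y1} \<times> {x2..<y2}) = (y1 - x1) * (y2 - x2)"
proof -
  have "emeasure lborel ({x1..<y1} \<times> {x2..<y2}) = emeasure lborel {x1..<y1} * emeasure lborel {x2..<y2}"
    unfolding lborel_prod [symmetric] by (intro lborel.emeasure_pair_measure_Times) auto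
  also have "\<dots> = ennreal ((y1 - x1) * (y2 - x2))"
    using assms by (simp add: ennreal_mult)
  finally show ?thesis using assms by (simp add: measure_def)
qed

section \<open>The dispersion\<close>

text \<open>After scaling by \<open>2 ^ m\<close> the sides are rounded outwards to integers; this enlarges the box, but no
  column or row is added to it.\<close>

lemma empty_box_measure_le:
  assumes "B \<in> boxes" "B \<inter> U_net m = {}"
  shows "measure lborel B \<le> 5 / 2 * (1 / 2 ^ m)"
proof -
  obtain x1 y1 x2 y2 where B: "B = {x1..<y1} \<times> {x2..<y2}"
    and bds: "0 \<le> x1" "x1 \<le> y1" "y1 \<le> 1" "0 \<le> x2" "x2 \<le> y2" "y2 \<le> 1"
    using assms(1) unfolding boxes_def by blast
  define N where "N = (2::real) ^ m"
  have N: "0 < N" by (simp add: N_def)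
  show ?thesis
  proof (cases "x1 = y1 \<or> x2 = y2")
    case True
    then show ?thesis using bds by (auto simp: B measure_box)
  next
    case False
    then have lt: "x1 * N < y1 * N" "x2 * N < y2 * N" using bds N by auto
    define a b c d where "a = max 0 (\<lceil>x1 * N\<rceil> - 1)" and "b = \<lceil>y1 * N\<rceil>"
      and "c = \<lceil>x2 * N\<rceil> - 1" and "d = \<lceil>y2 * N\<rceil>"
    have a: "real_of_int a \<le> x1 * N" and c: "real_of_int c \<le> x2 * N"
      using bds N ceiling_correct [of "x1 * N"] ceiling_correct [of "x2 * N"]
      by (auto simp: a_def c_def max_def)
    have b: "y1 * N \<le> real_of_int b" and d: "y2 * N \<le> real_of_int d"
      by (simp_all add: b_def d_def)
    have "y1 * N \<le> 1 * N" "y2 * N \<le> 1 * N" using bds N by (intro mult_right_mono; simp)+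
    then have "b \<le> 2 ^ m" "d \<le> 2 ^ m" by (simp_all add: b_def d_def N_def ceiling_le_iff)
    moreover have "0 \<le> a" by (simp add: a_def)
    moreover have "- 1 \<le> c"
    proof -
      have "0 \<le> x2 * N" using bds N by simp
      then have "-1 < x2 * N" by linarith
      then have "-1 < \<lceil>x2 * N\<rceil>" by (simp only: less_ceiling_iff of_int_minus of_int_1)
      then show ?thesis unfolding c_def by linarith
    qed
    moreover have "a < b" "c < d"
      using a b c d lt by linarith+
    moreover have "empty_box False m a b c d"
      unfolding empty_box_def
    proof (intro allI impI)
      fix n
      assume n: "a < int n" "int n < b" and h: "c < int (height False m n)" "int (height False m n) < d"
      have "int n < 2 ^ m" using n(2) \<open>b \<le> 2 ^ m\<close> by linarith
      then have "n < 2 ^ m" by simp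
      then have "(real n / N, real (height False m n) / N) \<in> U_net m"
        unfolding U_net_eq N_def by blast
      moreover have "\<lceil>x1 * N\<rceil> \<le> int n" "int n < \<lceil>y1 * N\<rceil>"
        "\<lceil>x2 * N\<rceil> \<le> int (height False m n)" "int (height False m n) < \<lceil>y2 * N\<rceil>"
        using n h unfolding a_def b_def c_def d_def by linarith+
      then have "x1 * N \<le> real n" "real n < y1 * N"
        "x2 * N \<le> real (height False m n)" "real (height False m n) < y2 * N"
        by (simp_all only: ceiling_le_iff less_ceiling_iff of_int_of_nat_eq)
      ultimately have "(real n / N, real (height False m n) / N) \<in> B \<inter> U_net m"
        using N by (simp add: B pos_le_divide_eq pos_divide_less_eq)
      with assms(2) show False by blast
    qed
    ultimately have "2 * (b - a) * (d - c) \<le> 5 * 2 ^ m" by (intro empty_box_area)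
    then have "real_of_int (2 * (b - a) * (d - c)) \<le> real_of_int (5 * 2 ^ m)"
      by (simp only: of_int_le_iff)
    then have "2 * (real_of_int b - a) * (real_of_int d - c) \<le> 5 * N" by (simp add: N_def)
    moreover have "(y1 * N - x1 * N) * (y2 * N - x2 * N) \<le> (real_of_int b - a) * (real_of_int d - c)"
      using a b c d lt by (intro mult_mono) linarith+
    ultimately have "2 * ((y1 * N - x1 * N) * (y2 * N - x2 * N)) \<le> 5 * N" by linarith
    moreover have "(y1 * N - x1 * N) * (y2 * N - x2 * N) = (y1 - x1) * (y2 - x2) * N * N"
      by (simp add: algebra_simps)
    ultimately have "(2 * ((y1 - x1) * (y2 - x2)) * N) * N \<le> 5 * N" by simp
    then have "2 * ((y1 - x1) * (y2 - x2)) * N \<le> 5"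
      using N by (rule mult_right_le_imp_le)
    then have "(y1 - x1) * (y2 - x2) \<le> 5 / 2 * (1 / N)"
      using N by (simp add: pos_le_divide_eq)
    then show ?thesis using bds by (simp add: B measure_box N_def)
  qed
qed

lemma height_small:
  "height False (3 + r) 3 = 2 * 2 ^ r" "height False (3 + r) 4 = 7 * 2 ^ r"
  "height False (3 + r) 5 = 3 * 2 ^ r" "height False (3 + r) 6 = 2 ^ r"
proof -
  have tail: "height False r 0 = 0" by (induction r) simp_all
  have "height False (Suc (Suc (Suc 0))) n
      = of_bool (thue_morse n) * 4 + of_bool (thue_morse (n div 2)) * 2
        + of_bool (thue_morse (n div 2 div 2))" for n
    by simp
  then have head: "height False 3 n
      = of_bool (thue_morse n) * 4 + of_bool (thue_morse (n div 2)) * 2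
        + of_bool (thue_morse (n div 2 div 2))" for n
    by (simp only: numeral_3_eq_3)
  have tm1: "thue_morse 1" by (subst thue_morse.simps) simp
  have tm2: "thue_morse 2" using tm1 thue_morse_double [of 1] by simp
  have tm4: "thue_morse 4" using tm2 thue_morse_double [of 2] by simp
  have tm3: "\<not> thue_morse 3" using tm1 by (subst thue_morse.simps) simp
  have tm5: "\<not> thue_morse 5" using tm2 by (subst thue_morse.simps) simp
  have tm6: "\<not> thue_morse 6" using tm3 thue_morse_double [of 3] by simp
  note tm = tm1 [simplified] tm2 tm3 tm4 tm5 tm6
  show "height False (3 + r) 3 = 2 * 2 ^ r" "height False (3 + r) 4 = 7 * 2 ^ r"
    "height False (3 + r) 5 = 3 * 2 ^ r" "height False (3 + r) 6 = 2 ^ r"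
    by (simp_all add: height_add head tail tm)
qed

text \<open>Column \<open>2\<close> and row \<open>3 / 8\<close> carry points of the net, and a box in the sense of the dispersion
  contains its left and lower sides; shifting these two sides by \<open>\<delta>\<close> makes the box empty. The
  supremum is thus approached as \<open>\<delta>\<close> tends to \<open>0\<close>.\<close>

lemma almost_extremal_box:
  fixes \<delta> :: real
  assumes "m \<ge> 3" "0 < \<delta>" "\<delta> < 1"
  shows "\<exists>B \<in> boxes. B \<inter> U_net m = {} \<and> measure lborel B = (5 - \<delta>) * (2 ^ m / 2 - \<delta>) / (2 ^ m * 2 ^ m)"
proof -
  obtain r where m: "m = 3 + r" using assms(1) le_Suc_ex by blast
  define N u where "N = (2::real) ^ m" and "u = (2::real) ^ r"
  have N: "N = 8 * u" and u: "1 \<le> u" by (simp_all add: N_def u_def m power_add)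
  define B where "B = {(2 + \<delta>) / N..<7 / N} \<times> {(3 * u + \<delta>) / N..<7 * u / N}"
  have "B \<in> boxes"
    unfolding boxes_def B_def mem_Collect_eq
    by (intro exI conjI, rule refl) (use assms u in \<open>auto simp: N field_simps\<close>)
  moreover have "B \<inter> U_net m = {}"
  proof -
    {
      fix n assume n: "(real n / 2 ^ m, real (height False m n) / 2 ^ m) \<in> B"
      then have "2 + \<delta> \<le> real n" "real n < 7"
        and h: "3 * u + \<delta> \<le> real (height False m n)" "real (height False m n) < 7 * u"
        using u by (auto simp: B_def N_def [symmetric] divide_le_cancel divide_less_cancel N
            pos_divide_less_eq)
      then have "2 < n" "n < 7" using assms by linarith+
      then consider "n = 3" | "n = 4" | "n = 5" | "n = 6" by linarith
      moreover have "real (height False m 3) = 2 * u" "real (height False m 4) = 7 * u"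
        "real (height False m 5) = 3 * u" "real (height False m 6) = u"
        by (simp_all add: m height_small u_def)
      ultimately have False
        using h u assms by cases auto
    }
    then show ?thesis unfolding U_net_eq by blast
  qed
  moreover have "measure lborel B = (5 - \<delta>) * (2 ^ m / 2 - \<delta>) / (2 ^ m * 2 ^ m)"
  proof -
    have "measure lborel B = (7 / N - (2 + \<delta>) / N) * (7 * u / N - (3 * u + \<delta>) / N)"
      unfolding B_def using assms u by (intro measure_box) (auto simp: N field_simps)
    also have "\<dots> = (5 - \<delta>) * (N / 2 - \<delta>) / (N * N)"
      using u by (simp add: N field_simps)
    finally show ?thesis by (simp add: N_def)
  qed
  ultimately show ?thesis by blast
qed

theorem theorem4p3:
  fixes m :: nat
  assumes "m \<ge> 4"
  shows "disp (digital_net m (J_mat m) (U_mat m)) = 5 / 2 * (1 / 2 ^ m)"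
proof (rule antisym)
  let ?\<B> = "{B \<in> boxes. B \<inter> U_net m = {}}"
  have bdd: "bdd_above (measure lborel ` ?\<B>)"
    using empty_box_measure_le by (intro bdd_aboveI2) blast
  have "?\<B> \<noteq> {}"
    using almost_extremal_box [of m "1 / 2"] assms by auto
  then show "disp (U_net m) \<le> 5 / 2 * (1 / 2 ^ m)"
    unfolding disp_def by (rule cSUP_least) (use empty_box_measure_le in blast)
  define N where "N = (2::real) ^ m"
  have N: "1 \<le> N" by (simp add: N_def)
  have lower: "(5 - \<delta>) * (N / 2 - \<delta>) / (N * N) \<le> disp (U_net m)" if \<delta>: "0 < \<delta>" "\<delta> < 1" for \<delta>
  proof -
    obtain B where "B \<in> ?\<B>" "measure lborel B = (5 - \<delta>) * (N / 2 - \<delta>) / (N * N)"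
      using almost_extremal_box [of m \<delta>] \<delta> assms unfolding N_def by auto
    moreover from this(1) have "measure lborel B \<le> disp (U_net m)"
      unfolding disp_def using bdd by (rule cSUP_upper)
    ultimately show ?thesis by simp
  qed
  have "((\<lambda>\<delta>. (5 - \<delta>) * (N / 2 - \<delta>) / (N * N)) \<longlongrightarrow> (5 - 0) * (N / 2 - 0) / (N * N)) (at_right 0)"
    using N by (intro tendsto_intros) auto
  moreover have "\<forall>\<^sub>F \<delta> in at_right 0. (5 - \<delta>) * (N / 2 - \<delta>) / (N * N) \<le> disp (U_net m)"
    by (rule eventually_at_rightI [of 0 1]) (use lower in auto)
  ultimately have "(5 - 0) * (N / 2 - 0) / (N * N) \<le> disp (U_net m)"
    by (rule tendsto_upperbound) simp
  then show "5 / 2 * (1 / 2 ^ m) \<le> disp (U_net m)"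
    using N by (simp add: N_def)
qed

end
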